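(* Suppose that $\alpha$ is a positive integer and write $\alpha=\prod_{n=1}^N p_n$ where the $p_n$ are not necessarily distinct primes. Assume the following hypothesis: for every rational number $\beta$ and every $t\in(0,\infty]$ there exist rational numbers $\beta_1,\ldots,\beta_K$ such that $M_t(\beta)^t=\sum_{k=1}^K M(\beta_k)^t$. Then for every positive real $t$, \begin{equation*} M_t(\alpha)^t = \begin{cases} (\log\alpha)^t & \text{if } t\le 1,\\ \sum_{n=1}^N(\log p_n)^t & \text{if } t\ge 1.\end{cases} \end{equation*}
   Context: For a non-zero algebraic number $\alpha$, $M(\alpha)$ denotes the logarithmic Mahler measure of its minimal polynomial over $\mathbb Z$: if $f(z)=a\prod_{n=1}^N(z-\alpha_n)$ then $M(f)=\log|a|+\sum_{n}\log^+|\alpha_n|$. In particular, for a positive integer $k$, $M(k)=\log k$, and for a rational $r/s$ in lowest terms, $M(r/s)=\log\max\{|r|,|s|\}$. For $t\in(0,\infty)$, the $t$-metric Mahler measure is \begin{equation*} M_t(\alpha)=\inf\Big\{\Big(\sum_{n\ge1} M(\alpha_n)^t\Big)^{1/t} : \alpha_n\in\overline{\mathbb Q}^{\times},\ \alpha_n=1 \text{ for all but finitely many } n,\ \prod_n\alpha_n=\alpha\Big\}, \end{equation*} the infimum over all ways of writing $\alpha$ as a finite product of non-zero algebraic numbers. *)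

theory Defs
  imports
    "HOL-Analysis.Analysis"
    "HOL-Computational_Algebra.Computational_Algebra"
begin

text \<open>Algebraic numbers are the complex numbers satisfying \<^const>\<open>algebraic\<close>.\<close>

text \<open>Irreducibility is over the integers, not the rationals: a constant other than
  \<open>1\<close> and \<open>-1\<close> is a non-unit of \<^typ>\<open>int poly\<close>, so a non-constant irreducible polynomial is
  primitive. The sign of the leading coefficient makes it unique.\<close>

definition min_int_poly :: "complex \<Rightarrow> int poly" where
  "min_int_poly \<alpha> =
     (THE f. irreducible f \<and> lead_coeff f > 0 \<and> poly (map_poly of_int f) \<alpha> = 0)"

definition log_mahler_poly :: "complex poly \<Rightarrow> real" where
  "log_mahler_poly f =
     ln (cmod (lead_coeff f)) + (\<Sum>z\<in>#proots f. ln (max 1 (cmod z)))"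

definition log_mahler :: "complex \<Rightarrow> real" where
  "log_mahler \<alpha> = log_mahler_poly (map_poly of_int (min_int_poly \<alpha>))"

definition alg_factorizations :: "complex \<Rightarrow> (nat \<Rightarrow> complex) set" where
  "alg_factorizations \<alpha> =
     {a. (\<forall>n. algebraic (a n) \<and> a n \<noteq> 0) \<and> finite {n. a n \<noteq> 1} \<and> (\<Prod>n. a n) = \<alpha>}"

definition metric_mahler :: "real \<Rightarrow> complex \<Rightarrow> real" where
  "metric_mahler t \<alpha> =
     Inf {(\<Sum>n. log_mahler (a n) powr t) powr (1 / t) | a. a \<in> alg_factorizations \<alpha>}"

text \<open>The case \<open>t = \<infinity>\<close>: the \<open>\<ell>\<^sup>t\<close> norm becomes the maximum norm. The range below is
  finite because all but finitely many \<open>a n\<close> are \<open>1\<close>.\<close>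

definition metric_mahler_infinity :: "complex \<Rightarrow> real" where
  "metric_mahler_infinity \<alpha> =
     Inf {Max (range (\<lambda>n. log_mahler (a n))) | a. a \<in> alg_factorizations \<alpha>}"

end

theory Submission
  imports Defs
begin

text \<open>Let \<open>\<alpha> = \<Prod>\<^sub>n \<alpha>\<^sub>n\<close> with algebraic \<open>\<alpha>\<^sub>n\<close>, and let \<open>r\<^sub>n\<close> be the absolute value of the constant
  coefficient of the minimal polynomial of \<open>\<alpha>\<^sub>n\<close>. Writing that coefficient as leading coefficient
  times product of roots shows \<open>log r\<^sub>n \<le> M(\<alpha>\<^sub>n)\<close>. Moreover \<open>r\<^sub>n / \<alpha>\<^sub>n\<close> is an algebraic integer,
  because \<open>1 / \<alpha>\<^sub>n\<close> is a root of the reversed polynomial, whose leading coefficient is \<open>\<plusminus> r\<^sub>n\<close>.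
  So \<open>(\<Prod>\<^sub>n r\<^sub>n) / \<alpha>\<close> is a rational algebraic integer, that is, \<open>\<alpha>\<close> divides \<open>\<Prod>\<^sub>n r\<^sub>n\<close>. The lower
  bounds for \<open>\<Sum>\<^sub>n M(\<alpha>\<^sub>n)\<^sup>t\<close> now follow from subadditivity (\<open>t \<le> 1\<close>) or superadditivity (\<open>t \<ge> 1\<close>)
  of \<open>x \<mapsto> x\<^sup>t\<close>; they are attained by \<open>\<alpha>\<close> itself and by its prime factorization respectively.\<close>

section \<open>Algebraic integers: a rational product of them is an integer\<close>

text \<open>The monic equation rewrites \<open>x ^ d\<close> through lower powers, so reducing after
  each multiplication by \<open>x\<close> never leaves their integer span. What matters later is
  that \<open>d\<close> does not depend on \<open>k\<close>.\<close>

lemma algebraic_int_power_span: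
  fixes x :: "'a::field_char_0"
  assumes "algebraic_int x"
  obtains d where "\<And>k. \<exists>c. x ^ k = (\<Sum>i<d. of_int (c i) * x ^ i)"
proof -
  from assms obtain p :: "int poly" where p: "poly (map_poly of_int p) x = 0" "lead_coeff p = 1"
    by (auto simp: algebraic_int_altdef_ipoly)
  define d where "d = degree p"
  have "0 = (\<Sum>i\<le>d. of_int (coeff p i) * x ^ i)"
    using p(1) by (simp add: poly_altdef d_def coeff_map_poly degree_map_poly)
  also have "\<dots> = (\<Sum>i<d. of_int (coeff p i) * x ^ i) + x ^ d"
    using p(2) by (simp add: d_def flip: lessThan_Suc_atMost)
  finally have xd: "x ^ d = (\<Sum>i<d. of_int (- coeff p i) * x ^ i)"
    by (simp add: sum_negf eq_neg_iff_add_eq_0 add.commute)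
  \<comment> \<open>For \<open>d = 0\<close> the relation \<open>xd\<close> would read
    \<open>1 = 0\<close>.\<close>
  obtain m where m: "d = Suc m"
    using xd by (cases d) auto
  have "\<exists>c. x ^ k = (\<Sum>i<d. of_int (c i) * x ^ i)" for k
  proof (induction k)
    case 0
    have "x ^ 0 = (\<Sum>i<d. of_int (if i = 0 then 1 else 0) * x ^ i)"
      by (simp add: m sum.lessThan_Suc_shift del: sum.lessThan_Suc)
    then show ?case by fast
  next
    case (Suc k)
    then obtain c where c: "x ^ k = (\<Sum>i<d. of_int (c i) * x ^ i)" by blast
    \<comment> \<open>Multiplication by \<open>x\<close> shifts the coefficients up by one; the
      overflow \<open>c m * x ^ d\<close> is rewritten by means of \<open>xd\<close>.\<close>
    define c' where
      "c' i = (case i of 0 \<Rightarrow> 0 | Suc j \<Rightarrow> c j) - c m * coeff p i" for i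
    have "x ^ Suc k = (\<Sum>i<d. of_int (c i) * x ^ Suc i)"
      by (simp add: c sum_distrib_left mult_ac)
    also have "\<dots> = (\<Sum>i<m. of_int (c i) * x ^ Suc i) + of_int (c m) * x ^ d"
      by (simp add: m)
    also have "(\<Sum>i<m. of_int (c i) * x ^ Suc i) =
        (\<Sum>i<d. of_int (case i of 0 \<Rightarrow> 0 | Suc j \<Rightarrow> c j) * x ^ i)"
      by (simp add: m sum.lessThan_Suc_shift del: sum.lessThan_Suc)
    also have "of_int (c m) * x ^ d = (\<Sum>i<d. of_int (- c m * coeff p i) * x ^ i)"
      by (subst xd) (simp add: sum_distrib_left mult_ac)
    also have "(\<Sum>i<d. of_int (case i of 0 \<Rightarrow> 0 | Suc j \<Rightarrow> c j) * x ^ i) + \<dots> =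
        (\<Sum>i<d. of_int (c' i) * x ^ i)"
      by (simp add: c'_def algebra_simps flip: sum.distrib)
    finally show ?case by blast
  qed
  then show thesis by (rule that)
qed

text \<open>The field is a vector space over the rationals in which \<open>{1}\<close> is
  independent, so sending 1 to 1 extends linearly. Such an \<open>f\<close> recovers
  \<open>q\<close> from \<open>of_rat q\<close> and carries integer relations in the field over to
  rationals.\<close>

lemma rat_linear_retraction:
  obtains f :: "'a::field_char_0 \<Rightarrow> rat"
    where "\<And>x y. f (x + y) = f x + f y" "\<And>q x. f (of_rat q * x) = q * f x" "f 1 = 1"
proof -
  interpret vector_space_pair "\<lambda>q x::'a. of_rat q * x" "(*) :: rat \<Rightarrow> rat \<Rightarrow> rat"
    by unfold_locales (auto simp: algebra_simps of_rat_add of_rat_mult)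
  have "vs1.independent {1::'a}" by simp
  from linear_independent_extend[OF this, of "\<lambda>_. 1"] obtain f :: "'a \<Rightarrow> rat"
    where f: "Vector_Spaces.linear (\<lambda>q x. of_rat q * x) (*) f" "f 1 = 1" by auto
  interpret f: Vector_Spaces.linear "\<lambda>q x::'a. of_rat q * x" "(*)" f by fact
  show thesis using that[of f] f.add f.scale f(2) by simp
qed

text \<open>For \<open>q = a / b\<close> in lowest terms, every \<open>b ^ k\<close> must divide the
  fixed non-zero \<open>D\<close>, which is possible only for \<open>b = 1\<close>.\<close>

lemma rat_in_Ints_if_powers_bounded_denom:
  fixes q :: rat and D :: int
  assumes "D \<noteq> 0" and D: "\<And>k. of_int D * q ^ k \<in> \<int>"
  shows "q \<in> \<int>"
proof -
  obtain a b where ab: "quotient_of q = (a, b)" by fastforce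
  have b: "b > 0" and cop: "coprime a b" and q: "q = of_int a / of_int b"
    using ab quotient_of_denom_pos quotient_of_coprime quotient_of_div by blast+
  have "b ^ k dvd D" for k
  proof -
    obtain n where "of_int D * q ^ k = of_int n" using D[of k] by (auto elim: Ints_cases)
    then have "(of_int (D * a ^ k) :: rat) = of_int (n * b ^ k)"
      using b by (simp add: q field_simps)
    then have "D * a ^ k = n * b ^ k" by (simp only: of_int_eq_iff)
    then have "b ^ k dvd D * a ^ k" by simp
    moreover have "coprime (b ^ k) (a ^ k)"
      using cop by (simp add: coprime_commute)
    ultimately show ?thesis by (simp add: coprime_dvd_mult_left_iff)
  qed
  \<comment> \<open>The exponent \<open>|D|\<close> already excludes \<open>b >= 2\<close>, since
    \<open>2 ^ |D|\<close> exceeds \<open>|D|\<close>.\<close>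
  then have "b ^ nat \<bar>D\<bar> \<le> \<bar>D\<bar>"
    using \<open>D \<noteq> 0\<close> by (metis dvd_abs_iff zdvd_imp_le zero_less_abs_iff)
  moreover have "\<bar>D\<bar> < 2 ^ nat \<bar>D\<bar>"
    using of_nat_less_two_power[of "nat \<bar>D\<bar>", where 'a=int] by simp
  ultimately have "\<not> 2 \<le> b"
    using power_mono[of 2 b "nat \<bar>D\<bar>"] by linarith
  then have "b = 1" using b by simp
  then show ?thesis by (simp add: q)
qed

text \<open>The powers of the product all lie in a finitely generated subgroup of the field.
  A \<open>\<rat>\<close>-linear retraction onto \<open>\<rat>\<close> maps that subgroup to rationals of bounded denominator.\<close>

lemma rational_prod_algebraic_int_is_int:
  fixes y :: "'b \<Rightarrow> 'a::field_char_0"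
  assumes "finite S" and y: "\<And>j. j \<in> S \<Longrightarrow> algebraic_int (y j)"
    and q: "(\<Prod>j\<in>S. y j) = of_rat q"
  shows "q \<in> \<int>"
proof -
  have "\<exists>d. \<forall>k. \<exists>c. y j ^ k = (\<Sum>i<d. of_int (c i) * y j ^ i)" if "j \<in> S" for j
    using algebraic_int_power_span[OF y[OF that]] by metis
  then obtain d where d: "\<And>j k. j \<in> S \<Longrightarrow> \<exists>c. y j ^ k = (\<Sum>i<d j. of_int (c i) * y j ^ i)"
    by metis
  obtain f :: "'a \<Rightarrow> rat" where f:
    "\<And>x y. f (x + y) = f x + f y" "\<And>q x. f (of_rat q * x) = q * f x" "f 1 = 1"
    using rat_linear_retraction by blast
  have f0: "f 0 = 0" using f(2)[of 0 0] by simp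
  have f_sum: "f (sum g A) = (\<Sum>x\<in>A. f (g x))" for g :: "('b \<Rightarrow> nat) \<Rightarrow> 'a" and A
    by (induction A rule: infinite_finite_induct) (auto simp: f0 f(1))
  \<comment> \<open>\<open>E\<close> indexes the finitely many monomials with exponents below
    \<open>d j\<close>; their integer span contains all powers of the product.\<close>
  define E where "E = (\<Pi>\<^sub>E j\<in>S. {..<d j})"
  define mon where "mon e = (\<Prod>j\<in>S. y j ^ e j)" for e :: "'b \<Rightarrow> nat"
  have "finite E" unfolding E_def using \<open>finite S\<close> by (intro finite_PiE) auto
  define den where "den e = snd (quotient_of (f (mon e)))" for e
  have den: "den e > 0" "of_int (den e) * f (mon e) \<in> \<int>" for e
  proof -
    obtain a b where ab: "quotient_of (f (mon e)) = (a, b)" by fastforce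
    have "b > 0" "f (mon e) = of_int a / of_int b"
      using ab quotient_of_denom_pos quotient_of_div by blast+
    moreover have "den e = b" by (simp add: den_def ab)
    ultimately show "den e > 0" "of_int (den e) * f (mon e) \<in> \<int>" by auto
  qed
  \<comment> \<open>A common denominator for the values of \<open>f\<close> on these
    monomials.\<close>
  define D where "D = (\<Prod>e\<in>E. den e)"
  have "D \<noteq> 0" using den(1) \<open>finite E\<close> by (simp add: D_def) (metis less_irrefl)
  have D_mon: "of_int D * f (mon e) \<in> \<int>" if "e \<in> E" for e
  proof -
    have "of_int D * f (mon e) = of_int (prod den (E - {e})) * (of_int (den e) * f (mon e))"
      unfolding D_def using \<open>finite E\<close> that by (subst prod.remove[of E e]) auto
    then show ?thesis using den(2) by (metis Ints_mult Ints_of_int)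
  qed
  have "of_int D * q ^ k \<in> \<int>" for k
  proof -
    obtain c where c: "\<And>j. j \<in> S \<Longrightarrow> y j ^ k = (\<Sum>i<d j. of_int (c j i) * y j ^ i)"
      using d[of _ k] by metis
    have "of_rat (q ^ k) = (\<Prod>j\<in>S. y j ^ k)"
      by (simp add: of_rat_power prod_power_distrib flip: q)
    also have "\<dots> = (\<Prod>j\<in>S. \<Sum>i<d j. of_int (c j i) * y j ^ i)"
      by (intro prod.cong) (simp_all add: c)
    \<comment> \<open>Distributing the product over the sums gives one term for each choice of
      exponents.\<close>
    also have "\<dots> = (\<Sum>e\<in>E. \<Prod>j\<in>S. of_int (c j (e j)) * y j ^ e j)"
      unfolding E_def using \<open>finite S\<close> by (intro prod_sum_PiE) auto
    also have "\<dots> = (\<Sum>e\<in>E. of_rat (of_int (\<Prod>j\<in>S. c j (e j))) * mon e)"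
      by (simp add: prod.distrib mon_def of_rat_prod)
    finally have "f (of_rat (q ^ k) * 1) = (\<Sum>e\<in>E. of_int (\<Prod>j\<in>S. c j (e j)) * f (mon e))"
      by (simp only: mult_1_right f_sum f(2))
    then have "of_int D * q ^ k = (\<Sum>e\<in>E. of_int (\<Prod>j\<in>S. c j (e j)) * (of_int D * f (mon e)))"
      unfolding f(2) f(3) by (simp add: sum_distrib_left mult_ac)
    then show ?thesis by (simp only:) (intro Ints_sum Ints_mult D_mon Ints_of_int)
  qed
  with \<open>D \<noteq> 0\<close> show ?thesis by (rule rat_in_Ints_if_powers_bounded_denom)
qed

section \<open>Roots of integer polynomials and the minimal polynomial over the integers\<close>

lemma degree_pos_if_int_root:
  fixes x :: "'a::field_char_0"
  assumes "poly (map_poly of_int p) x = 0" "p \<noteq> 0"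
  shows "degree p > 0"
  using assms by (intro Nat.gr0I) (auto elim!: degree_eq_zeroE simp: map_poly_pCons)

text \<open>With \<open>a\<close> the constant coefficient, multiplying the equation of
  \<open>x\<close> by \<open>a ^ (d - 1) / x ^ d\<close> turns it into a monic integer equation for
  \<open>a / x\<close>.\<close>

lemma algebraic_int_coeff_0_divide_root:
  fixes x :: "'a::field_char_0"
  assumes "poly (map_poly of_int p) x = 0" "p \<noteq> 0" "x \<noteq> 0"
  shows "algebraic_int (of_int (coeff p 0) / x)"
proof (cases "coeff p 0 = 0")
  case False
  define d where "d = degree p"
  define a where "a = coeff p 0"
  have "d > 0"
    unfolding d_def using assms(1,2) by (rule degree_pos_if_int_root)
  \<comment> \<open>\<open>g\<close> collects the terms of that equation below the leading one; each
    keeps an integer coefficient because \<open>i\<close> starts at 1.\<close>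
  define g where "g = (\<Sum>i\<in>{1..d}. monom (of_int (coeff p i * a ^ (i - 1)) :: 'a) (d - i))"
  have "degree g < d"
    unfolding g_def using \<open>d > 0\<close>
    by (intro degree_sum_less) (auto intro: le_less_trans[OF degree_monom_le])
  then have "lead_coeff (g + monom 1 d) = 1"
    by (subst lead_coeff_add_le) (auto simp: degree_monom_eq)
  moreover have "coeff (g + monom 1 d) i \<in> \<int>" for i
    unfolding g_def by (auto simp: coeff_sum intro!: Ints_add Ints_sum)
  moreover have "poly (g + monom 1 d) (of_int a / x) = 0"
  proof -
    have eq: "of_int (coeff p i * a ^ (i - 1)) * (of_int a / x) ^ (d - i) =
        of_int (coeff p i) * x ^ i * of_int a ^ (d - 1) / x ^ d" if "i \<in> {1..d}" for i
    proof -
      have "(of_int a :: 'a) ^ (d - 1) = of_int a ^ (i - 1) * of_int a ^ (d - i)"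
        using that by (simp flip: power_add)
      moreover have "x ^ d = x ^ i * x ^ (d - i)"
        using that by (simp flip: power_add)
      ultimately show ?thesis using \<open>x \<noteq> 0\<close> by (simp add: power_divide)
    qed
    have "0 = (\<Sum>i\<le>d. of_int (coeff p i) * x ^ i)"
      using assms(1) by (simp add: poly_altdef d_def coeff_map_poly degree_map_poly)
    also have "{..d} = insert 0 {1..d}" by auto
    finally have "0 = (of_int a + (\<Sum>i\<in>{1..d}. of_int (coeff p i) * x ^ i)) * of_int a ^ (d - 1) / x ^ d"
      by (simp add: a_def)
    also have "\<dots> = of_int a ^ d / x ^ d + (\<Sum>i\<in>{1..d}. of_int (coeff p i) * x ^ i * of_int a ^ (d - 1) / x ^ d)"
      using \<open>d > 0\<close>
      by (simp add: distrib_right add_divide_distrib sum_distrib_right sum_divide_distrib power_eq_if)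
    also have "\<dots> = of_int a ^ d / x ^ d +
        (\<Sum>i\<in>{1..d}. of_int (coeff p i * a ^ (i - 1)) * (of_int a / x) ^ (d - i))"
      by (intro arg_cong2[where f = "(+)"] refl sum.cong) (simp_all only: eq)
    also have "\<dots> = poly (g + monom 1 d) (of_int a / x)"
      by (simp add: g_def poly_sum poly_monom power_divide)
    finally show ?thesis by simp
  qed
  ultimately show ?thesis unfolding a_def by (intro algebraic_int.intros[of "g + monom 1 d"]) auto
qed auto

lemma poly_of_int_add:
  "poly (map_poly of_int (p + q)) x =
    poly (map_poly of_int p) x + poly (map_poly of_int q) (x :: 'a :: comm_ring_1)"
proof -
  have "map_poly of_int (p + q) = map_poly of_int p + (map_poly of_int q :: 'a poly)"
    by (rule poly_eqI) (simp add: coeff_map_poly)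
  then show ?thesis by simp
qed

lemma poly_of_int_mult:
  "poly (map_poly of_int (p * q)) x =
    poly (map_poly of_int p) x * poly (map_poly of_int q) (x :: 'a :: comm_ring_1)"
  by (induction p)
    (simp_all add: map_poly_pCons map_poly_smult poly_of_int_add algebra_simps)

text \<open>The primitive part of a non-zero polynomial of least degree vanishing at
  \<open>x\<close> will do. Irreducible integer polynomials are prime, so divisibility up to a
  constant factor becomes divisibility.\<close>

lemma ex_irreducible_int_poly_dvd:
  fixes x :: "'a::field_char_0"
  assumes "algebraic x"
  obtains f where "irreducible f" "poly (map_poly of_int f) x = 0"
    "\<And>g. poly (map_poly of_int g) x = 0 \<Longrightarrow> f dvd g"
proof -
  let ?e = "\<lambda>p. poly (map_poly of_int p) x"
  obtain g where "g \<noteq> 0 \<and> ?e g = 0" using algebraicE'[OF assms] by blast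
  then obtain h where h: "h \<noteq> 0" "?e h = 0" and h_min: "\<And>g. g \<noteq> 0 \<Longrightarrow> ?e g = 0 \<Longrightarrow> degree h \<le> degree g"
    using ex_has_least_nat[of "\<lambda>g. g \<noteq> 0 \<and> ?e g = 0" g degree] by blast
  define f where "f = primitive_part h"
  have h_eq: "h = [:content h:] * f" by (simp add: f_def)
  have f: "f \<noteq> 0" "content f = 1" "degree f = degree h" using h(1) by (simp_all add: f_def)
  have ef: "?e f = 0"
    using h by (subst (asm) (2) h_eq, subst (asm) poly_of_int_mult) (simp add: map_poly_pCons)
  \<comment> \<open>Minimality of the degree leaves only a constant for the cofactor
    \<open>v\<close>, and content 1 makes this constant a unit.\<close>
  have const_unit: "is_unit v" if "f = u * v" "?e u = 0" for u v
  proof -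
    have "degree u + degree v = degree h"
      using f(1,3) that(1) by (metis degree_mult_eq mult_eq_0_iff)
    moreover have "degree h \<le> degree u" using h_min that f(1) by auto
    ultimately have "degree v = 0" by simp
    then obtain c where c: "v = [:c:]" by (rule degree_eq_zeroE)
    then have "c dvd content f" by (simp add: that(1) const_poly_dvd_iff_dvd_content[symmetric])
    then show ?thesis by (simp add: c f(2) is_unit_const_poly_iff)
  qed
  have irr: "irreducible f"
  proof (rule irreducibleI)
    show "f \<noteq> 0" by fact
    show "\<not> is_unit f"
      using degree_pos_if_int_root[OF ef f(1)] by (auto simp: is_unit_poly_iff)
    fix u v assume uv: "f = u * v"
    then have "?e u = 0 \<or> ?e v = 0" using ef by (simp add: poly_of_int_mult)
    then show "is_unit u \<or> is_unit v"
      using const_unit[of u v] const_unit[of v u] uv by (auto simp: mult.commute)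
  qed
  have "f dvd g" if g: "?e g = 0" for g
  proof -
    \<comment> \<open>Pseudo-division stays within integer polynomials at the cost of the factor
      \<open>c\<close>. The remainder vanishes at \<open>x\<close> too, so minimality of the degree
      makes it zero.\<close>
    obtain c q where c: "c \<noteq> 0" "smult c g = f * q + pseudo_mod g f"
      using pseudo_mod(1)[OF f(1)] by blast
    have "?e (smult c g) = ?e (f * q) + ?e (pseudo_mod g f)" 
      by (simp only: c(2) poly_of_int_add)
    then have "?e (pseudo_mod g f) = 0" 
      by (simp add: poly_of_int_mult map_poly_smult g ef)
    then have "pseudo_mod g f = 0"
      using h_min[of "pseudo_mod g f"] pseudo_mod(2)[OF f(1), of g] f(3) by linarith
    then have "f dvd [:c:] * g" using c(2) by simp
    moreover have "prime_elem f" using irr by (rule irreducible_imp_prime_poly)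
    moreover have "\<not> f dvd [:c:]"
      using dvd_imp_degree_le[of f "[:c:]"] c(1) degree_pos_if_int_root[OF ef f(1)] by auto
    ultimately show ?thesis by (meson prime_elem_dvd_mult_iff)
  qed
  with irr ef show thesis by (rule that)
qed

text \<open>This justifies the \<open>THE\<close> in \<open>min_int_poly\<close>. Any candidate is a
  unit multiple of the polynomial just found, and positivity of the leading coefficient fixes the
  sign.\<close>

lemma ex1_min_int_poly:
  assumes "algebraic x"
  shows "\<exists>!f. irreducible f \<and> lead_coeff f > 0 \<and> poly (map_poly of_int f) (x::complex) = 0"
proof -
  obtain f where f: "irreducible f" "poly (map_poly of_int f) x = 0"
    "\<And>g. poly (map_poly of_int g) x = 0 \<Longrightarrow> f dvd g"
    using ex_irreducible_int_poly_dvd[OF assms] by blast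
  define f' where "f' = smult (sgn (lead_coeff f)) f"
  have "f \<noteq> 0" using f(1) by auto
  then have sgn: "sgn (lead_coeff f) = 1 \<or> sgn (lead_coeff f) = -1"
    by (auto simp: sgn_if)
  have "irreducible (- f)"
    using f(1) irreducible_mult_unit_left[of "- 1" f] by simp
  then have f': "irreducible f'" "lead_coeff f' > 0" "poly (map_poly of_int f') x = 0"
    using f(1,2) sgn \<open>f \<noteq> 0\<close> leading_coeff_neq_0[of f]
    by (auto simp: f'_def map_poly_smult sgn_if simp del: leading_coeff_0_iff split: if_splits)
  show ?thesis
  proof (rule ex1I[of _ f'])
    fix g assume g: "irreducible g \<and> lead_coeff g > 0 \<and> poly (map_poly of_int g) x = 0"
    then have "f' dvd g" using f(3)[of g] sgn by (auto simp: f'_def)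
    then obtain k where k: "g = f' * k" by auto
    then have "is_unit k" using g f'(1) by (meson irreducibleD irreducible_not_unit)
    then obtain c where c: "k = [:c:]" "is_unit c" by (auto simp: is_unit_poly_iff)
    have "c \<noteq> 0" using c(2) by auto
    then have "c * lead_coeff f' > 0" using g by (auto simp: k c lead_coeff_mult)
    then have "c > 0" using f'(2) by (simp add: zero_less_mult_iff)
    with c(2) have "c = 1" by simp
    then show "g = f'" by (simp add: k c)
  qed (use f' in auto)
qed

lemma min_int_poly:
  assumes "algebraic x"
  shows "irreducible (min_int_poly x)" "poly (map_poly of_int (min_int_poly x)) x = 0"
  using theI'[OF ex1_min_int_poly[OF assms]] by (auto simp: min_int_poly_def)

lemma min_int_poly_of_nat: "min_int_poly (of_nat k) = [:- int k, 1:]"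
  unfolding min_int_poly_def
proof (rule the1_equality[OF ex1_min_int_poly])
  show "algebraic (of_nat k :: complex)" by simp
qed (auto simp: map_poly_pCons intro: irreducible_linear_poly)

section \<open>The Mahler measure and the constant coefficient\<close>

lemma log_mahler_of_nat: "log_mahler (of_nat k) = ln (max 1 (real k))"
  by (simp add: log_mahler_def log_mahler_poly_def min_int_poly_of_nat map_poly_pCons)

lemma log_mahler_1: "log_mahler 1 = 0"
  using log_mahler_of_nat[of 1] by simp

lemma norm_prod_mset_le_exp:
  "cmod (\<Prod>z\<in>#A. - z) \<le> exp (\<Sum>z\<in>#A. ln (max 1 (cmod z)))"
proof (induction A)
  case (add z A)
  have "cmod z * cmod (\<Prod>z\<in>#A. - z) \<le> max 1 (cmod z) * exp (\<Sum>z\<in>#A. ln (max 1 (cmod z)))"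
    by (intro mult_mono add) auto
  then show ?case by (simp add: norm_mult exp_add)
qed simp

text \<open>The value at 0 is the leading coefficient times the product of the negated roots, and a
  root \<open>z\<close> has modulus at most \<open>max 1 (cmod z)\<close>.\<close>

lemma ln_norm_poly_0_le_log_mahler_poly:
  assumes "poly f 0 \<noteq> 0"
  shows "ln (cmod (poly f 0)) \<le> log_mahler_poly f"
proof -
  define P where "P = (\<Prod>z\<in>#proots f. - z)"
  have "poly f 0 = poly (smult (lead_coeff f) (\<Prod>z\<in>#proots f. [:- z, 1:])) 0"
    by (simp only: complex_poly_decompose_multiset)
  also have "\<dots> = lead_coeff f * P"
    by (simp add: P_def poly_prod_mset image_mset.compositionality o_def)
  finally have eq: "poly f 0 = lead_coeff f * P" .
  with assms have nz: "lead_coeff f \<noteq> 0" "P \<noteq> 0" by auto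
  have "ln (cmod P) \<le> ln (exp (\<Sum>z\<in>#proots f. ln (max 1 (cmod z))))"
    using nz norm_prod_mset_le_exp[of "proots f"] by (subst ln_le_cancel_iff) (auto simp: P_def)
  then show ?thesis
    using nz by (simp add: eq norm_mult ln_mult log_mahler_poly_def)
qed

lemma algebraic_denominator_log_mahler:
  assumes "algebraic x" "x \<noteq> 0"
  obtains r :: nat where "r > 0" "algebraic_int (of_nat r / x)" "ln (real r) \<le> log_mahler x"
proof -
  let ?p = "min_int_poly x"
  have p: "irreducible ?p" "poly (map_poly of_int ?p) x = 0"
    using min_int_poly[OF assms(1)] by auto
  then have "?p \<noteq> 0" by auto
  \<comment> \<open>Otherwise the variable splits off as a factor, and irreducibility leaves a
    constant multiple of it, whose only root is 0.\<close>
  have c0: "coeff ?p 0 \<noteq> 0"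
  proof
    assume "coeff ?p 0 = 0"
    then obtain q where q: "?p = [:0, 1:] * q" by (cases ?p) auto
    then have "is_unit q"
      using irreducibleD[OF p(1) q] by (auto simp: is_unit_poly_iff)
    then obtain c where "q = [:c:]" by (auto simp: is_unit_poly_iff)
    with p(2) q \<open>?p \<noteq> 0\<close> \<open>x \<noteq> 0\<close> show False by (auto simp: map_poly_pCons)
  qed
  let ?r = "nat \<bar>coeff ?p 0\<bar>"
  \<comment> \<open>The sign is harmless: negation preserves algebraic integers.\<close>
  have r: "(of_nat ?r :: complex) = of_int (coeff ?p 0) \<or> (of_nat ?r :: complex) = - of_int (coeff ?p 0)"
    by (simp add: abs_if)
  show thesis
  proof (rule that[of ?r])
    show "?r > 0" using c0 by simp
    show "algebraic_int (of_nat ?r / x)"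
      using algebraic_int_coeff_0_divide_root[OF p(2) \<open>?p \<noteq> 0\<close> assms(2)] r by auto
    have "poly (map_poly of_int ?p) 0 = (of_int (coeff ?p 0) :: complex)"
      by (simp add: poly_0_coeff_0 coeff_map_poly)
    then show "ln (real ?r) \<le> log_mahler x"
      using ln_norm_poly_0_le_log_mahler_poly[of "map_poly of_int ?p"] c0
      by (simp add: log_mahler_def)
  qed
qed

section \<open>Super- and subadditivity of powers\<close>

text \<open>After division by \<open>x + y\<close> both terms lie in \<open>[0, 1]\<close>, where an
  exponent of at least 1 does not increase a number. The subadditive case reverses this last
  comparison.\<close>

lemma powr_add_superadditive:
  fixes x y t :: real
  assumes "x \<ge> 0" "y \<ge> 0" "t \<ge> 1"
  shows "x powr t + y powr t \<le> (x + y) powr t"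
proof (cases "x + y = 0")
  case False
  define s where "s = x + y"
  have s: "s > 0" using False assms by (simp add: s_def)
  have "(x / s) powr t + (y / s) powr t \<le> (x / s) powr 1 + (y / s) powr 1"
    using assms s by (intro add_mono powr_mono') (auto simp: s_def)
  also have "\<dots> = 1" using assms s by (simp add: s_def flip: add_divide_distrib)
  finally show ?thesis
    using s assms by (simp add: powr_divide flip: s_def add_divide_distrib)
qed (use assms in \<open>auto simp: add_nonneg_eq_0_iff\<close>)

lemma powr_add_subadditive:
  fixes x y t :: real
  assumes "x \<ge> 0" "y \<ge> 0" "0 < t" "t \<le> 1"
  shows "(x + y) powr t \<le> x powr t + y powr t"
proof (cases "x + y = 0")
  case False
  define s where "s = x + y"
  have s: "s > 0" using False assms by (simp add: s_def)
  have "1 = (x / s) powr 1 + (y / s) powr 1" 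
    using assms s by (simp add: s_def flip: add_divide_distrib)
  also have "\<dots> \<le> (x / s) powr t + (y / s) powr t"
    using assms s by (intro add_mono powr_mono') (auto simp: s_def)
  finally show ?thesis
    using s assms by (simp add: powr_divide flip: s_def add_divide_distrib)
qed (use assms in \<open>auto simp: add_nonneg_eq_0_iff\<close>)

lemma sum_mset_real_nonneg:
  "(\<And>x. x \<in># A \<Longrightarrow> g x \<ge> 0) \<Longrightarrow> (\<Sum>x\<in>#A. g x) \<ge> (0::real)"
  by (induction A) auto

lemma sum_mset_powr_superadditive:
  fixes g :: "'a \<Rightarrow> real"
  assumes "\<And>x. x \<in># A \<Longrightarrow> g x \<ge> 0" "t \<ge> 1"
  shows "(\<Sum>x\<in>#A. g x powr t) \<le> (\<Sum>x\<in>#A. g x) powr t"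
  using assms(1)
proof (induction A)
  case (add x A)
  have "(\<Sum>x\<in>#A. g x) \<ge> 0" using add.prems by (intro sum_mset_real_nonneg) auto
  then have "g x powr t + (\<Sum>x\<in>#A. g x) powr t \<le> (g x + (\<Sum>x\<in>#A. g x)) powr t"
    using add.prems assms(2) by (intro powr_add_superadditive) auto
  with add show ?case by simp
qed simp

lemma sum_powr_subadditive:
  fixes g :: "'a \<Rightarrow> real"
  assumes "\<And>x. x \<in> A \<Longrightarrow> g x \<ge> 0" "0 < t" "t \<le> 1"
  shows "(\<Sum>x\<in>A. g x) powr t \<le> (\<Sum>x\<in>A. g x powr t)"
  using assms(1)
proof (induction A rule: infinite_finite_induct)
  case (insert x A)
  have "(g x + (\<Sum>x\<in>A. g x)) powr t \<le> g x powr t + (\<Sum>x\<in>A. g x) powr t"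
    using insert.prems assms(2,3) by (intro powr_add_subadditive sum_nonneg) auto
  with insert show ?case by simp
qed auto

lemma ln_prod_mset_nat:
  "(\<And>x. x \<in># A \<Longrightarrow> x > 0) \<Longrightarrow> ln (real (\<Prod>x\<in>#A. x)) = (\<Sum>x\<in>#A. ln (real x))"
proof (induction A)
  case (add x A)
  then have "(\<Prod>x\<in>#A. x) \<noteq> 0" by (auto simp: prod_mset_zero_iff)
  with add show ?case by (simp add: ln_mult)
qed simp

text \<open>\<open>ln m\<close> is the sum of the non-negative logarithms of the prime factors with
  multiplicity, so superadditivity applies.\<close>

lemma sum_prime_factorization_powr_le:
  fixes m :: nat
  assumes "m > 0" "t \<ge> 1"
  shows "(\<Sum>q\<in>#prime_factorization m. ln (real q) powr t) \<le> ln (real m) powr t"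
proof -
  have "(\<Sum>q\<in>#prime_factorization m. ln (real q) powr t)
      \<le> (\<Sum>q\<in>#prime_factorization m. ln (real q)) powr t"
    using assms(2) by (intro sum_mset_powr_superadditive)
      (auto dest!: in_prime_factors_imp_prime prime_ge_1_nat)
  also have "(\<Sum>q\<in>#prime_factorization m. ln (real q)) = ln (real (\<Prod>q\<in>#prime_factorization m. q))"
    by (rule ln_prod_mset_nat[symmetric]) (auto intro: prime_gt_0_nat)
  also have "(\<Prod>q\<in>#prime_factorization m. q) = m"
    using assms(1) by (simp add: prod_mset_prime_factorization_nat)
  finally show ?thesis .
qed

lemma sum_mset_sum:
  "finite S \<Longrightarrow> (\<Sum>x\<in>#(\<Sum>n\<in>S. A n). g x) = (\<Sum>n\<in>S. \<Sum>x\<in>#A n. g x)"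
  by (induction S rule: finite_induct) auto

section \<open>Lower bounds valid for every factorization\<close>

text \<open>This trades algebraic factors for positive integers whose logarithms are no larger than
  the measures; the price is that equality of products weakens to divisibility.\<close>

lemma alg_factorization_dvd:
  assumes "a \<in> alg_factorizations (of_nat m)"
  obtains r :: "nat \<Rightarrow> nat" where
    "\<And>n. r n > 0" "\<And>n. ln (real (r n)) \<le> log_mahler (a n)"
    "m dvd (\<Prod>n | a n \<noteq> 1. r n)"
proof -
  let ?S = "{n. a n \<noteq> 1}"
  have a: "\<And>n. algebraic (a n)" "\<And>n. a n \<noteq> 0" "finite ?S" "(\<Prod>n. a n) = of_nat m"
    using assms by (auto simp: alg_factorizations_def)
  have prod_a: "(\<Prod>n\<in>?S. a n) = of_nat m"
    unfolding a(4)[symmetric] using a(3) by (intro prodinf_finite[symmetric]) auto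
  then have "m \<noteq> 0" using a(2,3) by (metis of_nat_0 prod_zero_iff)
  have "\<exists>r. r > 0 \<and> algebraic_int (of_nat r / a n) \<and> ln (real r) \<le> log_mahler (a n)" for n
    using algebraic_denominator_log_mahler[OF a(1,2)] by metis
  then obtain r where r: "\<And>n. r n > 0" "\<And>n. algebraic_int (of_nat (r n) / a n)"
    "\<And>n. ln (real (r n)) \<le> log_mahler (a n)" by metis
  have "(\<Prod>n\<in>?S. of_nat (r n) / a n) = of_rat (of_nat (\<Prod>n\<in>?S. r n) / of_nat m)"
    by (simp add: prod_dividef prod_a of_rat_divide of_rat_prod)
  then have "(of_nat (\<Prod>n\<in>?S. r n) / of_nat m :: rat) \<in> \<int>"
    using r(2) a(3) by (intro rational_prod_algebraic_int_is_int) auto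
  then obtain k where "(of_nat (\<Prod>n\<in>?S. r n) / of_nat m :: rat) = of_int k"
    by (auto elim: Ints_cases)
  then have "(of_int (int (\<Prod>n\<in>?S. r n)) :: rat) = of_int (k * int m)"
    using \<open>m \<noteq> 0\<close> by (simp add: field_simps)
  then have "int (\<Prod>n\<in>?S. r n) = k * int m" by (simp only: of_int_eq_iff)
  then have "int m dvd int (\<Prod>n\<in>?S. r n)" by simp
  then have "m dvd (\<Prod>n\<in>?S. r n)" by (simp only: int_dvd_int_iff)
  with r show thesis by (intro that)
qed

lemma suminf_log_mahler:
  assumes "finite {n. a n \<noteq> 1}"
  shows "(\<Sum>n. log_mahler (a n) powr t) = (\<Sum>n | a n \<noteq> 1. log_mahler (a n) powr t)"
  \<comment> \<open>A factor 1 contributes \<open>0 powr t\<close>, which is 0 for every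
    \<open>t\<close>.\<close>
  using assms by (intro suminf_finite) (auto simp: log_mahler_1)

text \<open>Divisibility gives \<open>m <= (\<Prod>n\<in>?S. r n)\<close>; subadditivity then
  distributes the power over the factors.\<close>

lemma ln_powr_le_sum_log_mahler:
  assumes a: "a \<in> alg_factorizations (of_nat m)" and t: "0 < t" "t \<le> 1"
  shows "ln (real m) powr t \<le> (\<Sum>n. log_mahler (a n) powr t)"
proof -
  let ?S = "{n. a n \<noteq> 1}"
  have fin: "finite ?S" using a by (simp add: alg_factorizations_def)
  obtain r where r: "\<And>n. r n > 0" "\<And>n. ln (real (r n)) \<le> log_mahler (a n)" "m dvd (\<Prod>n\<in>?S. r n)"
    using alg_factorization_dvd[OF a] by blast
  have "(\<Prod>n\<in>?S. r n) > 0" using r(1) by (simp add: prod_pos)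
  then have m: "m > 0" "m \<le> (\<Prod>n\<in>?S. r n)" using r(3) by (auto intro: Nat.gr0I dvd_imp_le)
  have r0: "ln (real (r n)) \<ge> 0" for n using r(1)[of n] by simp
  have "ln (real m) \<le> ln (real (\<Prod>n\<in>?S. r n))"
    using m by (subst ln_le_cancel_iff) (auto simp del: of_nat_prod)
  also have "\<dots> = (\<Sum>n\<in>?S. ln (real (r n)))" using fin r(1) by (simp add: ln_prod)
  finally have "ln (real m) powr t \<le> (\<Sum>n\<in>?S. ln (real (r n))) powr t"
    using m t by (intro powr_mono2) auto
  also have "\<dots> \<le> (\<Sum>n\<in>?S. ln (real (r n)) powr t)"
    using r0 t by (intro sum_powr_subadditive) auto
  also have "\<dots> \<le> (\<Sum>n\<in>?S. log_mahler (a n) powr t)"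
    using r0 r(2) t by (intro sum_mono powr_mono2) auto
  finally show ?thesis by (simp add: suminf_log_mahler[OF fin])
qed

text \<open>Divisibility embeds the prime multiset of \<open>m\<close> into the sum of those of the
  \<open>r n\<close>; superadditivity then reassembles each \<open>r n\<close> from its
  primes.\<close>

lemma sum_prime_factorization_le_sum_log_mahler:
  assumes a: "a \<in> alg_factorizations (of_nat m)" and t: "t \<ge> 1"
  shows "(\<Sum>q\<in>#prime_factorization m. ln (real q) powr t) \<le> (\<Sum>n. log_mahler (a n) powr t)"
proof -
  let ?S = "{n. a n \<noteq> 1}"
  let ?g = "\<lambda>q::nat. ln (real q) powr t"
  have fin: "finite ?S" using a by (simp add: alg_factorizations_def)
  obtain r where r: "\<And>n. r n > 0" "\<And>n. ln (real (r n)) \<le> log_mahler (a n)" "m dvd (\<Prod>n\<in>?S. r n)"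
    using alg_factorization_dvd[OF a] by blast
  have "(\<Prod>n\<in>?S. r n) > 0" using r(1) by (simp add: prod_pos)
  then have "prime_factorization m \<subseteq># prime_factorization (\<Prod>n\<in>?S. r n)"
    using r(3) by (subst prime_factorization_subset_iff_dvd) auto
  also have "prime_factorization (\<Prod>n\<in>?S. r n) = (\<Sum>n\<in>?S. prime_factorization (r n))"
    using fin r(1) by (intro prime_factorization_prod) auto
  finally obtain B where "(\<Sum>n\<in>?S. prime_factorization (r n)) = prime_factorization m + B"
    by (auto simp: mset_subset_eq_exists_conv)
  \<comment> \<open>The surplus primes in \<open>B\<close> contribute non-negative terms.\<close>
  then have "(\<Sum>q\<in>#prime_factorization m. ?g q) \<le> (\<Sum>q\<in>#(\<Sum>n\<in>?S. prime_factorization (r n)). ?g q)"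
    by (auto intro!: sum_mset_real_nonneg)
  also have "\<dots> = (\<Sum>n\<in>?S. \<Sum>q\<in>#prime_factorization (r n). ?g q)"
    by (rule sum_mset_sum[OF fin])
  also have "\<dots> \<le> (\<Sum>n\<in>?S. ?g (r n))"
    using r(1) t by (intro sum_mono sum_prime_factorization_powr_le)
  also have "\<dots> \<le> (\<Sum>n\<in>?S. log_mahler (a n) powr t)"
  proof (intro sum_mono powr_mono2)
    show "0 \<le> ln (real (r n))" for n using r(1)[of n] by simp
  qed (use r(2) t in auto)
  finally show ?thesis by (simp add: suminf_log_mahler[OF fin])
qed

section \<open>Attaining the infimum\<close>

text \<open>A factorization that attains the bound makes the infimum a minimum, because the outer
  exponent \<open>1 / t\<close> is monotone.\<close>

lemma metric_mahler_powr_eqI: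
  assumes "t > 0" "a \<in> alg_factorizations \<alpha>" "(\<Sum>n. log_mahler (a n) powr t) = X" "X \<ge> 0"
    and le: "\<And>a. a \<in> alg_factorizations \<alpha> \<Longrightarrow> X \<le> (\<Sum>n. log_mahler (a n) powr t)"
  shows "metric_mahler t \<alpha> powr t = X"
proof -
  have "metric_mahler t \<alpha> = X powr (1 / t)"
    unfolding metric_mahler_def
  proof (rule cInf_eq_minimum)
    show "X powr (1 / t) \<in> {(\<Sum>n. log_mahler (a n) powr t) powr (1 / t) | a. a \<in> alg_factorizations \<alpha>}"
      using assms(2,3) by blast
  qed (use le assms(1,4) in \<open>auto intro!: powr_mono2\<close>)
  then show ?thesis using assms(1,4) by (simp add: powr_powr)
qed

text \<open>Finitely many positive integers become a sequence by padding with 1, which has measure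
  0.\<close>

lemma nat_alg_factorization:
  fixes b :: "nat \<Rightarrow> nat"
  assumes "finite S" "\<And>n. n \<in> S \<Longrightarrow> b n > 0"
  defines "a \<equiv> (\<lambda>n. if n \<in> S then of_nat (b n) else 1)"
  shows "a \<in> alg_factorizations (of_nat (\<Prod>n\<in>S. b n))"
    and "(\<Sum>n. log_mahler (a n) powr t) = (\<Sum>n\<in>S. ln (real (b n)) powr t)"
proof -
  have "(\<Prod>n. a n) = (\<Prod>n\<in>S. a n)"
    using assms(1) by (intro prodinf_finite) (auto simp: a_def)
  also have "\<dots> = of_nat (\<Prod>n\<in>S. b n)" by (simp add: a_def)
  finally show "a \<in> alg_factorizations (of_nat (\<Prod>n\<in>S. b n))"
    using assms(1,2) finite_subset[of "{n. a n \<noteq> 1}" S]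
    by (auto simp: alg_factorizations_def a_def)
  have "(\<Sum>n. log_mahler (a n) powr t) = (\<Sum>n\<in>S. log_mahler (a n) powr t)"
    using assms(1) by (intro suminf_finite) (auto simp: a_def log_mahler_1)
  also have "\<dots> = (\<Sum>n\<in>S. ln (real (b n)) powr t)"
    using assms(2) by (intro sum.cong) (auto simp: a_def log_mahler_of_nat max_def dest: Suc_leI)
  finally show "(\<Sum>n. log_mahler (a n) powr t) = (\<Sum>n\<in>S. ln (real (b n)) powr t)" .
qed

theorem theorem2p3:
  fixes \<alpha> N :: nat and p :: "nat \<Rightarrow> nat" and t :: real
  assumes "\<alpha> > 0"
    and "\<forall>n\<in>{1..N}. prime (p n)"
    and "\<alpha> = (\<Prod>n=1..N. p n)"
    and rational_finite:
      "\<forall>\<beta>::rat. \<forall>s::real. \<beta> \<noteq> 0 \<longrightarrow> s > 0 \<longrightarrow>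
         (\<exists>(K::nat) (b :: nat \<Rightarrow> rat). K \<ge> 1 \<and> (\<forall>k\<in>{1..K}. b k \<noteq> 0) \<and>
            metric_mahler s (of_rat \<beta>) powr s = (\<Sum>k=1..K. log_mahler (of_rat (b k)) powr s))"
    and rational_infinity:
      "\<forall>\<beta>::rat. \<beta> \<noteq> 0 \<longrightarrow>
         (\<exists>(K::nat) (b :: nat \<Rightarrow> rat). K \<ge> 1 \<and> (\<forall>k\<in>{1..K}. b k \<noteq> 0) \<and>
            metric_mahler_infinity (of_rat \<beta>) = Max ((\<lambda>k. log_mahler (of_rat (b k))) ` {1..K}))"
    and "t > 0"
  shows "(t \<le> 1 \<longrightarrow> metric_mahler t (of_nat \<alpha>) powr t = ln (real \<alpha>) powr t) \<and>
         (t \<ge> 1 \<longrightarrow> metric_mahler t (of_nat \<alpha>) powr t = (\<Sum>n=1..N. ln (real (p n)) powr t))"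
proof (intro conjI impI)
  assume "t \<le> 1"
  \<comment> \<open>The bound is attained with \<alpha> as the single factor, placed at index
    0.\<close>
  then show "metric_mahler t (of_nat \<alpha>) powr t = ln (real \<alpha>) powr t"
    using nat_alg_factorization[of "{0}" "\<lambda>_. \<alpha>"] \<open>\<alpha> > 0\<close> \<open>t > 0\<close>
    by (intro metric_mahler_powr_eqI ln_powr_le_sum_log_mahler) auto
next
  assume "t \<ge> 1"
  have p_pos: "p n > 0" if "n \<in> {1..N}" for n
    using assms(2) that prime_gt_0_nat by blast
  \<comment> \<open>Unique factorization identifies the given \<open>p n\<close> with the prime
    multiset in the lower bound, which the factorization \<open>p\<close> then attains.\<close>
  have "prime_factorization \<alpha> = (\<Sum>n=1..N. prime_factorization (p n))"
    unfolding assms(3) using p_pos by (intro prime_factorization_prod) auto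
  also have "\<dots> = (\<Sum>n=1..N. {#p n#})"
    using assms(2) by (intro sum.cong) (auto simp: prime_factorization_prime)
  finally have "(\<Sum>q\<in>#prime_factorization \<alpha>. ln (real q) powr t) = (\<Sum>n=1..N. ln (real (p n)) powr t)"
    by (simp add: sum_mset_sum)
  then show "metric_mahler t (of_nat \<alpha>) powr t = (\<Sum>n=1..N. ln (real (p n)) powr t)"
    using nat_alg_factorization[of "{1..N}" p] p_pos \<open>t > 0\<close> \<open>t \<ge> 1\<close>
      sum_prime_factorization_le_sum_log_mahler[of _ \<alpha> t]
    by (intro metric_mahler_powr_eqI) (auto simp: assms(3) intro!: sum_nonneg)
qed

end
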